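(* For every formula $\phi$ of univariate real arithmetic (built from rational polynomials as in the context), the decision procedures $\mathtt{decide\_universal}$ and $\mathtt{decide\_existential}$ defined in the context satisfy $$\bigl(\forall x\in\mathbb{R},\ \phi \text{ is true at } x\bigr)\iff \mathtt{decide\_universal}(\phi)=\text{true},$$ $$\bigl(\exists x\in\mathbb{R},\ \phi \text{ is true at } x\bigr)\iff \mathtt{decide\_existential}(\phi)=\text{true}.$$
   Context: **Formulas.** Formulas are generated by $\phi,\psi ::= g>0 \mid g\ge 0\mid g=0\mid \phi\vee\psi\mid\phi\wedge\psi$, where $g\in\mathbb{Q}[x]$. Truth of $\phi$ at $x\in\mathbb{R}$ is defined in the obvious recursive way, by evaluating each polynomial at $x$. **Sign conventions.** $\mathrm{sgn}(y)\in\{-1,0,+1\}$ is the sign of a real $y$. A sign vector for a list of $m$ polynomials is a list of $m$ elements of $\{-1,0,1\}$. Given a formula $\phi$ with list of polynomials $g_1,\dots,g_k$ and a sign vector $\sigma$ for this list, the truth value of $\phi$ at $\sigma$ is obtained by replacing each polynomial $g_j$ in $\phi$ by the number $\sigma_j$ and evaluating. **Top level.** Let $G=[g_1,\dots,g_k]$ be the list of polynomials occurring in $\phi$, and let $L=\mathtt{find\_consistent\_signs}(G)$ be the list of sign vectors for $G$ computed below. $\mathtt{decide\_universal}(\phi)$ is true iff $\phi$ is true at every $\sigma$ in $L$. $\mathtt{decide\_existential}(\phi)$ is true iff $\phi$ is true at some $\sigma$ in $L$. **$\mathtt{find\_consistent\_signs}(G)$.** 1. A fixed factorization procedure over $\mathbb{Q}$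 computes a list $Q=[q_1,\dots,q_n]$ of squarefree, pairwise coprime factors in $\mathbb{Q}[x]$ of the input polynomials, such that each $g_j=c_j\prod_{i=1}^n q_i^{d_{j,i}}$ for some $c_j\in\mathbb{Q}$ and integers $d_{j,i}\ge 0$. 2. For each $1\le i\le n$ compute $\mathtt{FCSR}(q_i,\,Q\text{ with }q_i\text{ removed})$ and insert the entry $0$ at position $i$ in each resulting sign vector, giving the sign vectors for $Q$ in which exactly $q_i$ is zero. 3. Compute a polynomial $p\neq 0$ such that: (i) $p$ is coprime with each $q_i$; (ii) $p$ has a root in every interval between any two roots of the $q_i$'s; (iii) $p$ has a root greater than all roots of the $q_i$'s; (iv) $p$ has a root smaller than all roots of the $q_i$'s. The choice made is $p=(x-\mathrm{crb}(f))(x+\mathrm{crb}(f))f'$, where $f=\prod_i q_i$, $f'$ is its derivative, and $\mathrm{crb}(f)$ is a computable positive integer with larger magnitude than any real root of $f$. 4. Compute $\mathtt{FCSR}(p,Q)$. 5. For each sign vector $\tau$ for $Q$ obtained in steps 2 and 4, output the sign vector for $G$ recovered from it through the factorization in step 1, i.e. with $j$-th entry $\mathrm{sgn}(c_j)\prod_i \tau_i^{d_{j,i}}$ (with $0^0=1$). **$\mathtt{FCSR}(p,qs)$** ($\mathtt{find\_consistent\_signs\_at\_roots}$). For a nonzero real polynomial $p$ and a list $qs$ of real polynomials each coprime with $p$, it returns the third component $\Sigma$ of $\mathtt{calc\_data}(p,qs)=(M,S,\Sigma)$. Here $M$ is a rational matrix, $S$ is a list of lists of indices into $qs$ (indices start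 at $0$), and $\Sigma$ is a list of sign vectors. Rows of $M$ correspond to entries of $S$ and columns to entries of $\Sigma$. *Tarski query:* for polynomials $p\ne0$ and $q$, $N(p,q)=\#\{x\in\mathbb{R}: p(x)=0,\,q(x)>0\}-\#\{x\in\mathbb{R}: p(x)=0,\,q(x)<0\}$; it is computed by Euclidean remainder sequences (Sturm–Tarski theorem). *Base data:* $\mathtt{base}=\left(\begin{pmatrix}1&1\\1&-1\end{pmatrix},\,[[\,],[0]],\,[[1],[-1]]\right)$. *Combination:* $\mathtt{combine}((qs_1,(M_1,S_1,\Sigma_1)),(qs_2,(M_2,S_2,\Sigma_2)))=(qs,(M,S,\Sigma))$. Here $qs$ is the concatenation of $qs_1$ and $qs_2$, and $M$ is the Kronecker product $M_1\otimes M_2$. $S$ lists all concatenations of an entry of $S_1$ with an entry of $S_2$ whose indices have all been increased by the length of $qs_1$. $\Sigma$ lists all concatenations of an entry of $\Sigma_1$ with an entry of $\Sigma_2$. The lists are ordered compatibly with the rows and columns of $M$. *Reduction:* $\mathtt{reduce}(p,(qs,(M,S,\Sigma)))$ returns a triple $(M',S',\Sigma')$. Let $v$ be the vector with entries $v_i=N(p,\prod_{k\in S_i}qs_k)$ and let $w=M^{-1}v$ ($M$ is invertible at every stage of the procedure; this is an invariant of the construction). Delete from $M$ the columns $j$ with $w_j=0$ and delete the corresponding entries of $\Sigma$, giving a matrix $A$ and the list $\Sigma'$. Let $R$ be the list of column indices of the pivots (first nonzero entries of the nonzero rows) of the reduced row echelon form of $A^T$. Then $M'$ consists of the rows of $A$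 indexed by $R$, and $S'$ of the entries of $S$ indexed by $R$. *Recursion:* let $\ell$ be the length of $qs$. - If $\ell=0$: compute $\mathtt{reduce}(p,([1],\mathtt{base}))$, where $[1]$ is the list containing the constant polynomial $1$, and delete the first entry of each sign vector in the third component. - If $\ell=1$: $\mathtt{calc\_data}(p,qs)=\mathtt{reduce}(p,(qs,\mathtt{base}))$. - If $\ell\ge2$: let $qs_1$ be the first $\lfloor \ell/2\rfloor$ entries of $qs$ and $qs_2$ the remaining ones. Then $\mathtt{calc\_data}(p,qs)=\mathtt{reduce}(p,\mathtt{combine}((qs_1,\mathtt{calc\_data}(p,qs_1)),(qs_2,\mathtt{calc\_data}(p,qs_2))))$.
   Formalization: When f is constant (f′ = 0), the stated choice p = (x − crb(f))(x + crb(f))f′ would be 0, contrary to the requirement p ≠ 0; in that case the factor f′ is dropped and p = (x − crb(f))(x + crb(f)) is used. *)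

theory Defs
  imports
    Complex_Main
    "HOL-Computational_Algebra.Computational_Algebra"
    "HOL-Computational_Algebra.Field_as_Ring"
    "Jordan_Normal_Form.Gauss_Jordan_Elimination"
begin

section \<open>Formulas\<close>

datatype fml =
    Gt "rat poly"    \<comment> \<open>g > 0\<close>
  | Geq "rat poly"   \<comment> \<open>g >= 0\<close>
  | Eq "rat poly"    \<comment> \<open>g = 0\<close>
  | Or fml fml
  | And fml fml

text \<open>The truth value after replacing every polynomial \<open>g\<close> in the formula by the number \<open>v g\<close>.\<close>

fun holds :: "(rat poly \<Rightarrow> 'a::linordered_idom) \<Rightarrow> fml \<Rightarrow> bool" where
  "holds v (Gt g) \<longleftrightarrow> v g > 0"
| "holds v (Geq g) \<longleftrightarrow> v g \<ge> 0"
| "holds v (Eq g) \<longleftrightarrow> v g = 0"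
| "holds v (Or a b) \<longleftrightarrow> holds v a \<or> holds v b"
| "holds v (And a b) \<longleftrightarrow> holds v a \<and> holds v b"

abbreviation real_poly :: "rat poly \<Rightarrow> real poly" where
  "real_poly \<equiv> map_poly of_rat"

definition true_at :: "fml \<Rightarrow> real \<Rightarrow> bool" where
  "true_at \<phi> x \<longleftrightarrow> holds (\<lambda>g. poly (real_poly g) x) \<phi>"

fun atom_polys :: "fml \<Rightarrow> rat poly list" where
  "atom_polys (Gt g) = [g]"
| "atom_polys (Geq g) = [g]"
| "atom_polys (Eq g) = [g]"
| "atom_polys (Or a b) = atom_polys a @ atom_polys b"
| "atom_polys (And a b) = atom_polys a @ atom_polys b"

text \<open>Duplicates are removed, so that the entry of a sign vector belonging to a
  polynomial of the formula is unambiguous.\<close>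

definition polys_of :: "fml \<Rightarrow> rat poly list" where
  "polys_of \<phi> = remdups (atom_polys \<phi>)"

text \<open>Sign vectors are lists over \<open>{-1, 0, 1}\<close>, taken inside the rationals.\<close>

type_synonym sign_vec = "rat list"

definition true_at_signs :: "fml \<Rightarrow> sign_vec \<Rightarrow> bool" where
  "true_at_signs \<phi> \<sigma> \<longleftrightarrow> holds (\<lambda>g. the (map_of (zip (polys_of \<phi>) \<sigma>) g)) \<phi>"


section \<open>Consistent signs at the roots of a polynomial\<close>

definition tarski_query :: "real poly \<Rightarrow> real poly \<Rightarrow> int" where
  "tarski_query p q =
     int (card {x. poly p x = 0 \<and> poly q x > 0}) - int (card {x. poly p x = 0 \<and> poly q x < 0})"

text \<open>The triples \<open>(M, S, \<Sigma>)\<close>.\<close>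

type_synonym sign_data = "rat mat \<times> nat list list \<times> sign_vec list"

definition base :: sign_data where
  "base = (mat_of_rows_list 2 [[1, 1], [1, -1]], [[], [0]], [[1], [-1]])"

definition kronecker_product :: "'a::times mat \<Rightarrow> 'a mat \<Rightarrow> 'a mat" where
  "kronecker_product A B = mat (dim_row A * dim_row B) (dim_col A * dim_col B)
     (\<lambda>(i, j). A $$ (i div dim_row B, j div dim_col B) * B $$ (i mod dim_row B, j mod dim_col B))"

fun combine :: "real poly list \<times> sign_data \<Rightarrow> real poly list \<times> sign_data
    \<Rightarrow> real poly list \<times> sign_data" where
  "combine (qs1, (M1, S1, \<Sigma>1)) (qs2, (M2, S2, \<Sigma>2)) =
     (qs1 @ qs2,
      (kronecker_product M1 M2,
       [s1 @ map (\<lambda>k. k + length qs1) s2. s1 \<leftarrow> S1, s2 \<leftarrow> S2],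
       [\<sigma>1 @ \<sigma>2. \<sigma>1 \<leftarrow> \<Sigma>1, \<sigma>2 \<leftarrow> \<Sigma>2]))"

text \<open>\<^const>\<open>row_echelon_form\<close> in the matrix library is the \<^emph>\<open>reduced\<close> row echelon form.\<close>

definition pivot_columns :: "rat mat \<Rightarrow> nat list" where
  "pivot_columns B = map snd (pivot_positions (gauss_jordan_single B))"

fun reduce :: "real poly \<Rightarrow> real poly list \<times> sign_data \<Rightarrow> sign_data" where
  "reduce p (qs, (M, S, \<Sigma>)) =
     (let v = vec_of_list (map (\<lambda>s. of_int (tarski_query p (\<Prod>k\<leftarrow>s. qs ! k))) S);
          w = the (mat_inverse M) *\<^sub>v v;
          J = filter (\<lambda>j. w $ j \<noteq> 0) [0..<dim_col M];
          A = mat_of_cols (dim_row M) (map (col M) J);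
          \<Sigma>' = map ((!) \<Sigma>) J;
          R = pivot_columns (transpose_mat A)
      in (mat_of_rows (dim_col A) (map (row A) R), map ((!) S) R, \<Sigma>'))"

function calc_data :: "real poly \<Rightarrow> real poly list \<Rightarrow> sign_data" where
  "calc_data p qs =
     (if length qs = 0 then
        (case reduce p ([1], base) of (M, S, \<Sigma>) \<Rightarrow> (M, S, map tl \<Sigma>))
      else if length qs = 1 then reduce p (qs, base)
      else
        let qs1 = take (length qs div 2) qs;
            qs2 = drop (length qs div 2) qs
        in reduce p (combine (qs1, calc_data p qs1) (qs2, calc_data p qs2)))"
  by pat_completeness auto
termination
proof (relation "measure (\<lambda>(p, qs). length qs)", goal_cases)
  case (3 p qs)
  then have "length qs - length qs div 2 < length qs" by linarith
  then show ?case using 3 by auto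
qed auto

declare calc_data.simps [simp del]

definition FCSR :: "real poly \<Rightarrow> real poly list \<Rightarrow> sign_vec list" where
  "FCSR p qs = snd (snd (calc_data p qs))"


section \<open>The decision procedures\<close>

text \<open>\<open>is_factorization G (Q, c, d)\<close>: the polynomials \<open>Q\<close>, constants \<open>c j\<close> and exponents
  \<open>d j i\<close> are an admissible output of the factorization step on the input \<open>G\<close>.\<close>

fun is_factorization ::
  "rat poly list \<Rightarrow> rat poly list \<times> (nat \<Rightarrow> rat) \<times> (nat \<Rightarrow> nat \<Rightarrow> nat) \<Rightarrow> bool" where
  "is_factorization G (Q, c, d) \<longleftrightarrow>
     (\<forall>q\<in>set Q. squarefree q \<and> (\<exists>g\<in>set G. q dvd g)) \<and>
     (\<forall>i<length Q. \<forall>i'<length Q. i \<noteq> i' \<longrightarrow> coprime (Q ! i) (Q ! i')) \<and>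
     (\<forall>j<length G. G ! j = Polynomial.smult (c j) (\<Prod>i<length Q. (Q ! i) ^ d j i))"

definition factorization_procedure ::
  "(rat poly list \<Rightarrow> rat poly list \<times> (nat \<Rightarrow> rat) \<times> (nat \<Rightarrow> nat \<Rightarrow> nat)) \<Rightarrow> bool" where
  "factorization_procedure factorize \<longleftrightarrow> (\<forall>G. is_factorization G (factorize G))"

definition root_bound_procedure :: "(rat poly \<Rightarrow> nat) \<Rightarrow> bool" where
  "root_bound_procedure crb \<longleftrightarrow>
     (\<forall>f. f \<noteq> 0 \<longrightarrow> crb f > 0 \<and> (\<forall>x. poly (real_poly f) x = 0 \<longrightarrow> \<bar>x\<bar> < real (crb f)))"

definition remove_at :: "nat \<Rightarrow> 'a list \<Rightarrow> 'a list" where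
  "remove_at i xs = take i xs @ drop (Suc i) xs"

definition insert_at :: "nat \<Rightarrow> 'a \<Rightarrow> 'a list \<Rightarrow> 'a list" where
  "insert_at i x xs = take i xs @ x # drop i xs"

text \<open>The polynomial \<open>(x - crb f) * (x + crb f) * f'\<close>. If \<open>f\<close> is constant, then \<open>f' = 0\<close>; as the
  result has to be nonzero, the factor \<open>f'\<close> is left out in that case.\<close>

definition sample_poly :: "(rat poly \<Rightarrow> nat) \<Rightarrow> rat poly \<Rightarrow> rat poly" where
  "sample_poly crb f =
     [:- of_nat (crb f), 1:] * [:of_nat (crb f), 1:] * (if pderiv f = 0 then 1 else pderiv f)"

definition factor_signs :: "(rat poly \<Rightarrow> nat) \<Rightarrow> rat poly list \<Rightarrow> sign_vec list" where
  "factor_signs crb Q =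
     concat (map (\<lambda>i. map (insert_at i 0)
       (FCSR (real_poly (Q ! i)) (map real_poly (remove_at i Q)))) [0..<length Q])
     @ FCSR (real_poly (sample_poly crb (prod_list Q))) (map real_poly Q)"

definition find_consistent_signs ::
  "(rat poly list \<Rightarrow> rat poly list \<times> (nat \<Rightarrow> rat) \<times> (nat \<Rightarrow> nat \<Rightarrow> nat)) \<Rightarrow> (rat poly \<Rightarrow> nat)
    \<Rightarrow> rat poly list \<Rightarrow> sign_vec list" where
  "find_consistent_signs factorize crb G =
     (case factorize G of (Q, c, d) \<Rightarrow>
        map (\<lambda>\<tau>. map (\<lambda>j. sgn (c j) * (\<Prod>i<length Q. (\<tau> ! i) ^ d j i)) [0..<length G])
          (factor_signs crb Q))"

definition decide_universal ::
  "(rat poly list \<Rightarrow> rat poly list \<times> (nat \<Rightarrow> rat) \<times> (nat \<Rightarrow> nat \<Rightarrow> nat)) \<Rightarrow> (rat poly \<Rightarrow> nat)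
    \<Rightarrow> fml \<Rightarrow> bool" where
  "decide_universal factorize crb \<phi> \<longleftrightarrow>
     list_all (true_at_signs \<phi>) (find_consistent_signs factorize crb (polys_of \<phi>))"

definition decide_existential ::
  "(rat poly list \<Rightarrow> rat poly list \<times> (nat \<Rightarrow> rat) \<times> (nat \<Rightarrow> nat \<Rightarrow> nat)) \<Rightarrow> (rat poly \<Rightarrow> nat)
    \<Rightarrow> fml \<Rightarrow> bool" where
  "decide_existential factorize crb \<phi> \<longleftrightarrow>
     list_ex (true_at_signs \<phi>) (find_consistent_signs factorize crb (polys_of \<phi>))"


section \<open>Factorization procedures and root bounds exist\<close>

lemma root_bound_procedure_exists: "\<exists>crb. root_bound_procedure crb"
proof -
  have "\<exists>n::nat. n > 0 \<and> (\<forall>x. poly (real_poly f) x = 0 \<longrightarrow> \<bar>x\<bar> < real n)" if "f \<noteq> 0" for f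
  proof -
    have "real_poly f \<noteq> 0"
      using that by (simp add: map_poly_eq_0_iff)
    then have fin: "finite {x. poly (real_poly f) x = 0}"
      by (rule poly_roots_finite)
    define B where "B = Max (insert 0 (abs ` {x. poly (real_poly f) x = 0}))"
    obtain n :: nat where n: "B < real n"
      using reals_Archimedean2 by blast
    have "\<bar>x\<bar> \<le> B" if "poly (real_poly f) x = 0" for x
      unfolding B_def using fin that by (intro Max_ge) auto
    moreover have "0 \<le> B"
      unfolding B_def using fin by (intro Max_ge) auto
    ultimately show ?thesis
      using n by (intro exI[of _ n]) force
  qed
  then obtain crb where
    "\<And>f. f \<noteq> 0 \<Longrightarrow> crb f > 0 \<and> (\<forall>x. poly (real_poly f) x = 0 \<longrightarrow> \<bar>x\<bar> < real (crb f))"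
    by metis
  then show ?thesis
    unfolding root_bound_procedure_def by blast
qed

lemma factorization_exists: "\<exists>F. is_factorization G F"
proof -
  define P where "P = \<Prod>(set G - {0})"
  have "P \<noteq> 0" by (simp add: P_def)
  define Q where "Q = (SOME Q. set Q = prime_factors P \<and> distinct Q)"
  have Q: "set Q = prime_factors P" "distinct Q"
    using someI_ex[OF finite_distinct_list[OF finite_set_mset[of "prime_factorization P"]]]
    unfolding Q_def by auto
  have prime: "prime q" if "q \<in> set Q" for q
    using that Q by auto
  have "squarefree q \<and> (\<exists>g\<in>set G. q dvd g)" if q: "q \<in> set Q" for q
  proof -
    have "q dvd (\<Prod>g\<in>set G - {0}. g)"
      using q Q by (auto simp: P_def)
    then obtain g where "g \<in> set G - {0}" "q dvd g"
      using prime[OF q] prime_dvd_prod_iff[of "set G - {0}" q "\<lambda>g. g"] by auto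
    then show ?thesis
      using prime[OF q] squarefree_prime by auto
  qed
  moreover have "coprime (Q ! i) (Q ! i')"
    if "i < length Q" "i' < length Q" "i \<noteq> i'" for i i'
    using that Q(2) by (intro primes_coprime prime) (auto simp: nth_eq_iff_index_eq)
  moreover have "G ! j = Polynomial.smult (lead_coeff (G ! j)) (\<Prod>i<length Q. (Q ! i) ^ multiplicity (Q ! i) (G ! j))"
    if j: "j < length G" for j
  proof (cases "G ! j = 0")
    case False
    let ?g = "G ! j"
    have "?g dvd P"
      unfolding P_def using False j by (intro dvd_prod_eqI[of _ ?g _ "\<lambda>g. g"]) auto
    then have sub: "prime_factors ?g \<subseteq> set Q"
      using \<open>P \<noteq> 0\<close> Q(1) by (simp add: dvd_prime_factors)
    have "(\<Prod>i<length Q. (Q ! i) ^ multiplicity (Q ! i) ?g) = (\<Prod>q\<in>set Q. q ^ multiplicity q ?g)"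
      using Q(2) by (intro prod.reindex_bij_betw bij_betw_nth) auto
    also have "\<dots> = (\<Prod>q\<in>prime_factors ?g. q ^ multiplicity q ?g)"
    proof (rule prod.mono_neutral_right)
      show "\<forall>q\<in>set Q - prime_factors ?g. q ^ multiplicity q ?g = 1"
      proof
        fix q assume q: "q \<in> set Q - prime_factors ?g"
        then have "\<not> q dvd ?g"
          using prime[of q] False by (auto simp: in_prime_factors_iff)
        then show "q ^ multiplicity q ?g = 1"
          by (simp add: not_dvd_imp_multiplicity_0)
      qed
    qed (use sub in auto)
    also have "\<dots> = normalize ?g"
      using False by (rule prod_prime_factors)
    finally have eq: "(\<Prod>i<length Q. (Q ! i) ^ multiplicity (Q ! i) ?g) = normalize ?g" .
    have "?g = unit_factor ?g * normalize ?g" by simp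
    also have "unit_factor ?g = [:lead_coeff ?g:]"
      using False by (simp add: unit_factor_poly_def)
    finally show ?thesis unfolding eq by simp
  qed simp
  ultimately have "is_factorization G
      (Q, \<lambda>j. lead_coeff (G ! j), \<lambda>j i. multiplicity (Q ! i) (G ! j))"
    by (simp del: One_nat_def)
  then show ?thesis ..
qed

lemma factorization_procedure_exists: "\<exists>factorize. factorization_procedure factorize"
  unfolding factorization_procedure_def using factorization_exists by metis

end

theory Submission
  imports Defs "Jordan_Normal_Form.Determinant"
begin

text \<open>
  Call the sign vector of \<open>qs\<close> at a real number the list of signs of the values of \<open>qs\<close> there. The
  data \<open>(M, S, \<Sigma>)\<close> computed for \<open>p\<close> and \<open>qs\<close> always satisfies: \<open>M\<close> is invertible, its entry at
  \<open>(i, j)\<close> is the product of the entries of \<open>\<Sigma>\<^sub>j\<close> with index in \<open>S\<^sub>i\<close>, and \<open>\<Sigma>\<close> contains, without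
  repetition, the sign vectors at all roots of \<open>p\<close>. Summing signs over the roots shows \<open>v = M w\<close>,
  where \<open>w\<^sub>j\<close> is the number of roots with sign vector \<open>\<Sigma>\<^sub>j\<close>. Hence the reduction step keeps exactly
  the sign vectors that occur. It stays within the invariant because a matrix with independent
  columns restricts to an invertible matrix on its pivot rows, and the combination step does because
  Kronecker products of invertible matrices are invertible.

  A real number that is a root of some factor is covered by the root of that factor. The remaining
  reals lie in intervals without roots of the product \<open>f\<close> of the factors, on which all signs are
  constant; by Rolle's theorem and the root bound each such interval contains a root of the sample
  polynomial, which has no root in common with \<open>f\<close> because \<open>f\<close> is squarefree.
\<close>

section \<open>Invertible matrices\<close>

text \<open>\<open>invertible_mat\<close> asks for a two-sided inverse; for square matrices over a
  field a left inverse is also a right inverse.\<close>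

lemma invertible_mat_leftI:
  fixes A :: "'a::field mat"
  assumes "A \<in> carrier_mat n n" "B \<in> carrier_mat n n" "B * A = 1\<^sub>m n"
  shows "invertible_mat A"
proof -
  have "A * B = 1\<^sub>m n"
    using mat_mult_left_right_inverse[OF assms(2,1,3)] .
  with assms show ?thesis
    by (auto simp: invertible_mat_def inverts_mat_def intro!: exI[of _ B])
qed

text \<open>Links the abstract predicate to the computed inverse: an invertible matrix is a unit of
  the matrix ring, so \<open>mat_inverse\<close> cannot return \<open>None\<close> and
  \<open>the (mat_inverse M)\<close> in \<open>reduce\<close> is meaningful.\<close>

lemma invertible_mat_obtain_inverse:
  fixes A :: "'a::field mat"
  assumes "A \<in> carrier_mat n n" "invertible_mat A"
  obtains B where "mat_inverse A = Some B" "B \<in> carrier_mat n n" "B * A = 1\<^sub>m n" "A * B = 1\<^sub>m n"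
proof -
  obtain B where B: "A * B = 1\<^sub>m n" "B * A = 1\<^sub>m (dim_row B)"
    using assms by (auto simp: invertible_mat_def inverts_mat_def)
  have "dim_col B = n"
    using B(1) by (metis index_mult_mat(3) index_one_mat(3))
  moreover have "dim_row B = n"
    using B(2) assms(1) by (metis carrier_matD(2) index_mult_mat(3) index_one_mat(3))
  ultimately have Bc: "B \<in> carrier_mat n n" by auto
  have "A \<in> Units (ring_mat TYPE('a) n ())"
    using B Bc assms(1) unfolding Units_def ring_mat_def by auto
  then obtain C where "mat_inverse A = Some C"
    using mat_inverse(1)[OF assms(1)] by fastforce
  with mat_inverse(2)[OF assms(1) this] that show ?thesis by blast
qed

text \<open>The left inverse \<open>L\<close> expresses that the columns of \<open>A\<close> are
  independent. The transpose of \<open>A\<close> then has full row rank, so each of its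
  \<open>m\<close> rows yields a pivot, and the pivot columns form an invertible square
  matrix.\<close>

lemma pivot_columns_left_invertible:
  fixes A :: "rat mat"
  assumes A: "A \<in> carrier_mat n m" and L: "L \<in> carrier_mat m n" and LA: "L * A = 1\<^sub>m m"
  defines "R \<equiv> pivot_columns (transpose_mat A)"
  shows "length R = m" and "set R \<subseteq> {..<n}"
    and "invertible_mat (mat_of_rows m (map (row A) R))"
proof -
  define E where "E = gauss_jordan_single (transpose_mat A)"
  have At: "transpose_mat A \<in> carrier_mat m n" using A by simp
  note gj = gauss_jordan_single[OF At E_def[symmetric]]
  obtain P Q where E: "E = P * transpose_mat A" and P: "P \<in> carrier_mat m m"
    and Q: "Q \<in> carrier_mat m m" and PQ: "P * Q = 1\<^sub>m m" "Q * P = 1\<^sub>m m"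
    using gj(4) by blast
  have Ec: "E \<in> carrier_mat m n" using gj(2) .
  obtain f where f: "pivot_fun E f n"
    using gj(3) Ec unfolding row_echelon_form_def by auto
  \<comment> \<open>Transposing \<open>L * A = 1\<close> gives a right inverse of the transpose of
    \<open>A\<close>; since \<open>E\<close> is \<open>P\<close> times that transpose, multiplying
    by the inverse \<open>Q\<close> of \<open>P\<close> corrects the extra factor.\<close>
  have EX: "E * (transpose_mat L * Q) = 1\<^sub>m m"
  proof -
    have "E * (transpose_mat L * Q) = E * transpose_mat L * Q"
      using Ec L Q by (simp add: assoc_mult_mat[of _ m n _ m _ m])
    also have "E * transpose_mat L = P * (transpose_mat A * transpose_mat L)"
      unfolding E using P At L by (simp add: assoc_mult_mat[of _ m m _ n _ m])
    also have "transpose_mat A * transpose_mat L = transpose_mat (L * A)"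
      using transpose_mult[OF L A] by simp
    finally show ?thesis using P PQ LA by simp
  qed
  \<comment> \<open>A zero row of \<open>E\<close> would force a zero on the diagonal of the
    identity matrix \<open>EX\<close>.\<close>
  have nz: "row E i \<noteq> 0\<^sub>v n" if i: "i < m" for i
  proof
    assume 0: "row E i = 0\<^sub>v n"
    have c: "col (transpose_mat L * Q) i \<in> carrier_vec n"
      using L Q by (intro carrier_vecI) simp
    have "1 = (E * (transpose_mat L * Q)) $$ (i, i)"
      unfolding EX using i by simp
    also have "\<dots> = row E i \<bullet> col (transpose_mat L * Q) i"
      using i Ec L Q by (subst index_mult_mat) auto
    also have "\<dots> = 0" unfolding 0 using c by simp
    finally show False by simp
  qed
  \<comment> \<open>In a \<open>pivot_fun\<close> the value \<open>n\<close> marks a zero row, so a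
    nonzero row has its pivot in a genuine column.\<close>
  have fn: "f i < n" if "i < m" for i
    using nz[OF that] pivot_fun_zero_row_iff[OF f Ec that] pivot_funD(1)[OF _ f that] Ec by fastforce
  note pp = pivot_positions[OF Ec f]
  define pp where "pp = pivot_positions E"
  have lenpp: "length pp = m"
  proof -
    have "{i. i < m \<and> row E i \<noteq> 0\<^sub>v n} = {..<m}" using nz by auto
    then show ?thesis using pp(4) by (simp add: pp_def)
  qed
  have R: "R = map snd pp"
    unfolding R_def pivot_columns_def pp_def E_def ..
  show lenR: "length R = m" using lenpp R by simp
  \<comment> \<open>Every row of the echelon form \<open>E = P * A\<^sup>T\<close> is nonzero, so its pivot columns, which are \<open>P\<close>
    times the selected rows of \<open>A\<close>, form the permutation matrix \<open>G\<close> given by \<open>g\<close>.\<close>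
  define g where "g k = fst (pp ! k)" for k
  have gk: "g k < m" "R ! k = f (g k)" if "k < m" for k
  proof -
    have "pp ! k \<in> set pp" using that lenpp by simp
    then show "g k < m" "R ! k = f (g k)"
      using pp(1) that lenpp unfolding pp_def[symmetric] g_def R by auto
  qed
  have g_inj: "g k = g l \<longleftrightarrow> k = l" if "k < m" "l < m" for k l
    using nth_eq_iff_index_eq[OF pp(2)[folded pp_def], of k l] that lenpp by (simp add: g_def)
  have Rn: "R ! k < n" if "k < m" for k using gk[OF that] fn by simp
  then show "set R \<subseteq> {..<n}" using lenR by (auto simp: in_set_conv_nth)
  define B where "B = mat_of_rows m (map (row A) R)"
  have B: "B \<in> carrier_mat m m" unfolding B_def using lenR by auto
  define G where "G = mat m m (\<lambda>(i,k). if i = g k then 1 else 0 :: rat)"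
  have G: "G \<in> carrier_mat m m" by (simp add: G_def)
  have PB: "P * transpose_mat B = G"
  proof (rule eq_matI)
    fix i k assume "i < dim_row G" "k < dim_col G"
    then have i: "i < m" and k: "k < m" by (auto simp: G_def)
    have "col (transpose_mat B) k = col (transpose_mat A) (R ! k)"
      using k lenR Rn[OF k] A by (auto simp: B_def mat_of_rows_index)
    then have "(P * transpose_mat B) $$ (i, k) = E $$ (i, R ! k)"
      unfolding E using i k P A B Rn[OF k] by simp
    also have "\<dots> = G $$ (i, k)"
      using i k gk[OF k] fn[OF gk(1)[OF k]] pivot_funD(4,5)[OF _ f gk(1)[OF k]] Ec
      by (auto simp: G_def)
    finally show "(P * transpose_mat B) $$ (i, k) = G $$ (i, k)" .
  qed (use P B in \<open>auto simp: G_def\<close>)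
  \<comment> \<open>The transpose of a permutation matrix is its inverse.\<close>
  have GG: "transpose_mat G * G = 1\<^sub>m m"
  proof (rule eq_matI)
    fix k l assume "k < dim_row (1\<^sub>m m :: rat mat)" "l < dim_col (1\<^sub>m m :: rat mat)"
    then have k: "k < m" and l: "l < m" by auto
    have "(transpose_mat G * G) $$ (k, l) =
        (\<Sum>i<m. (if i = g k then 1 else 0) * (if i = g l then 1 else 0))"
      using k l by (simp add: G_def scalar_prod_def atLeast0LessThan)
    also have "\<dots> = (\<Sum>i<m. if i = g k then (if g k = g l then 1 else 0) else 0)"
      by (intro sum.cong) auto
    also have "\<dots> = (if k = l then 1 else 0)"
      using gk(1)[OF k] g_inj[OF k l] by simp
    finally show "(transpose_mat G * G) $$ (k, l) = 1\<^sub>m m $$ (k, l)"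
      using k l by simp
  qed (auto simp: G_def)
  \<comment> \<open>So \<open>transpose_mat G * P\<close> inverts the transpose of \<open>B\<close>,
    on both sides because the matrices are square; transposing yields a left inverse of
    \<open>B\<close>.\<close>
  have "(transpose_mat G * P) * transpose_mat B = 1\<^sub>m m"
    using G P B PB GG by (simp add: assoc_mult_mat[of _ m m _ m _ m])
  then have "transpose_mat B * (transpose_mat G * P) = 1\<^sub>m m"
    by (rule mat_mult_left_right_inverse[rotated 2]) (use G P B in auto)
  then have "transpose_mat (transpose_mat B * (transpose_mat G * P)) = 1\<^sub>m m"
    by simp
  then have "transpose_mat (transpose_mat G * P) * B = 1\<^sub>m m"
    using G P B by (subst (asm) transpose_mult[of _ m m _ m]) auto
  then have "invertible_mat B"
    using G P B by (intro invertible_mat_leftI[of B m "transpose_mat (transpose_mat G * P)"]) auto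
  then show "invertible_mat (mat_of_rows m (map (row A) R))"
    unfolding B_def .
qed

text \<open>Choosing rows \<open>J\<close> of \<open>N\<close> and columns \<open>J\<close> of
  \<open>M\<close> selects a principal submatrix of \<open>N * M\<close>, again an identity. This
  supplies the left inverse for the pivot lemma once columns have been deleted.\<close>

lemma columns_left_inverse:
  assumes M: "M \<in> carrier_mat n n" and N: "N \<in> carrier_mat n n" and NM: "N * M = 1\<^sub>m n"
    and J: "distinct J" "set J \<subseteq> {..<n}"
  shows "mat_of_rows n (map (row N) J) * mat_of_cols n (map (col M) J) = 1\<^sub>m (length J)"
proof (rule eq_matI)
  fix a b assume "a < dim_row (1\<^sub>m (length J))" "b < dim_col (1\<^sub>m (length J))"
  then have a: "a < length J" and b: "b < length J" by auto
  then have Jn: "J ! a < n" "J ! b < n" using J by (auto simp: subset_iff)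
  have "(mat_of_rows n (map (row N) J) * mat_of_cols n (map (col M) J)) $$ (a, b) =
      row N (J ! a) \<bullet> col M (J ! b)"
    using a b Jn M N by simp
  also have "\<dots> = (N * M) $$ (J ! a, J ! b)"
    using Jn M N by simp
  also have "\<dots> = 1\<^sub>m (length J) $$ (a, b)"
    unfolding NM using Jn a b J by (simp add: nth_eq_iff_index_eq)
  finally show "(mat_of_rows n (map (row N) J) * mat_of_cols n (map (col M) J)) $$ (a, b) =
    1\<^sub>m (length J) $$ (a, b)" .
qed auto

section \<open>Kronecker products\<close>

lemma kronecker_product_dim [simp]:
  "dim_row (kronecker_product A B) = dim_row A * dim_row B"
  "dim_col (kronecker_product A B) = dim_col A * dim_col B"
  by (auto simp: kronecker_product_def)

lemma div_mod_less_mult: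
  fixes i :: nat
  assumes "i < a * b"
  shows "i div b < a" "i mod b < b"
  using assms by (auto simp: less_mult_imp_div_less) (metis mod_less_divisor mult_0_right neq0_conv not_less0)

text \<open>Division by \<open>b\<close> identifies the indices below \<open>a * b\<close> with
  pairs of quotient and remainder, which is how Kronecker products are indexed.\<close>

lemma sum_div_mod:
  "(\<Sum>i<a * b. f (i div b) (i mod b)) = (\<Sum>i<a. \<Sum>j<b. f i (j::nat))"
proof (cases "b = 0")
  case False
  have "(\<Sum>i<a * b. f (i div b) (i mod b)) = (\<Sum>(i, j)\<in>{..<a} \<times> {..<b}. f i j)"
  proof (rule sum.reindex_bij_witness[of _ "\<lambda>(i, j). i * b + j" "\<lambda>i. (i div b, i mod b)"])
    fix x assume x: "x \<in> {..<a} \<times> {..<b}"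
    obtain i j where [simp]: "x = (i, j)" "i < a" "j < b" using x by auto
    have "i * b + j < Suc i * b" by simp
    also have "\<dots> \<le> a * b" by (intro mult_le_mono1) (simp add: Suc_leI)
    finally show "(case x of (i, j) \<Rightarrow> i * b + j) \<in> {..<a * b}" by simp
  qed (use False in \<open>auto simp: div_mod_less_mult\<close>)
  then show ?thesis by (simp add: sum.cartesian_product)
qed simp

text \<open>The mixed product rule: the sum over the joint index becomes a double sum, and this
  factors into the two entries.\<close>

lemma kronecker_product_mult:
  fixes A B C D :: "'a::comm_semiring_0 mat"
  assumes "dim_col A = dim_row C" "dim_col B = dim_row D"
  shows "kronecker_product A B * kronecker_product C D = kronecker_product (A * C) (B * D)"
proof (rule eq_matI)
  fix i j assume "i < dim_row (kronecker_product (A * C) (B * D))"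
    "j < dim_col (kronecker_product (A * C) (B * D))"
  then have ij: "i < dim_row A * dim_row B" "j < dim_col C * dim_col D" by simp_all
  note dm = div_mod_less_mult[OF ij(1)] div_mod_less_mult[OF ij(2)]
  let ?i1 = "i div dim_row B" and ?i2 = "i mod dim_row B"
  let ?j1 = "j div dim_col D" and ?j2 = "j mod dim_col D"
  have "(kronecker_product A B * kronecker_product C D) $$ (i, j) =
     (\<Sum>k<dim_row C * dim_row D. A $$ (?i1, k div dim_row D) * B $$ (?i2, k mod dim_row D) *
        (C $$ (k div dim_row D, ?j1) * D $$ (k mod dim_row D, ?j2)))"
    using ij assms
    by (simp add: scalar_prod_def atLeast0LessThan)
       (auto simp: kronecker_product_def assms intro!: sum.cong)
  also have "\<dots> = (\<Sum>k<dim_row C. \<Sum>l<dim_row D.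
      A $$ (?i1, k) * B $$ (?i2, l) * (C $$ (k, ?j1) * D $$ (l, ?j2)))"
    by (rule sum_div_mod)
  also have "\<dots> = (\<Sum>k<dim_row C. A $$ (?i1, k) * C $$ (k, ?j1)) *
      (\<Sum>l<dim_row D. B $$ (?i2, l) * D $$ (l, ?j2))"
    unfolding sum_product by (intro sum.cong refl) (simp add: ac_simps)
  also have "\<dots> = (A * C) $$ (?i1, ?j1) * (B * D) $$ (?i2, ?j2)"
    using dm assms by (simp add: scalar_prod_def atLeast0LessThan)
  also have "\<dots> = kronecker_product (A * C) (B * D) $$ (i, j)"
    using ij by (simp add: kronecker_product_def)
  finally show "(kronecker_product A B * kronecker_product C D) $$ (i, j) =
    kronecker_product (A * C) (B * D) $$ (i, j)" .
qed simp_all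

lemma kronecker_product_one:
  "kronecker_product (1\<^sub>m a) (1\<^sub>m b) = (1\<^sub>m (a * b) :: 'a::semiring_1 mat)"
proof (rule eq_matI)
  fix i j assume "i < dim_row (1\<^sub>m (a * b) :: 'a mat)" "j < dim_col (1\<^sub>m (a * b) :: 'a mat)"
  then have ij: "i < a * b" "j < a * b" by auto
  have "i = j \<longleftrightarrow> i div b = j div b \<and> i mod b = j mod b"
    by (metis div_mult_mod_eq)
  then show "kronecker_product (1\<^sub>m a) (1\<^sub>m b) $$ (i, j) = (1\<^sub>m (a * b) :: 'a mat) $$ (i, j)"
    using ij div_mod_less_mult[OF ij(1)] div_mod_less_mult[OF ij(2)]
    by (auto simp: kronecker_product_def)
qed simp_all

text \<open>By the mixed product rule the Kronecker product of the inverses is an inverse.\<close>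

lemma invertible_kronecker_product:
  fixes A B :: "'a::field mat"
  assumes "A \<in> carrier_mat a a" "B \<in> carrier_mat b b" "invertible_mat A" "invertible_mat B"
  shows "invertible_mat (kronecker_product A B)"
proof -
  obtain A' where A': "A' \<in> carrier_mat a a" "A' * A = 1\<^sub>m a"
    using invertible_mat_obtain_inverse[OF assms(1,3)] by metis
  obtain B' where B': "B' \<in> carrier_mat b b" "B' * B = 1\<^sub>m b"
    using invertible_mat_obtain_inverse[OF assms(2,4)] by metis
  have "kronecker_product A' B' * kronecker_product A B = 1\<^sub>m (a * b)"
    using assms A' B' by (subst kronecker_product_mult) (auto simp: kronecker_product_one)
  then show ?thesis
    using assms A' B' by (intro invertible_mat_leftI[of _ "a * b"]) (auto intro!: carrier_matI)
qed

section \<open>Sign vectors at roots\<close>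

text \<open>Rational-valued, so that signs of real values can be entries of a
  \<open>sign_vec\<close>.\<close>

definition sgn_rat :: "real \<Rightarrow> rat" where
  "sgn_rat x = (if x > 0 then 1 else if x < 0 then -1 else 0)"

lemma sgn_rat_simps [simp]:
  "sgn_rat 0 = 0" "sgn_rat 1 = 1"
  "sgn_rat x = 0 \<longleftrightarrow> x = 0" "sgn_rat x > 0 \<longleftrightarrow> x > 0"
  by (auto simp: sgn_rat_def)

lemma sgn_rat_mult: "sgn_rat (x * y) = sgn_rat x * sgn_rat y"
  by (auto simp: sgn_rat_def zero_less_mult_iff mult_less_0_iff)

lemma sgn_rat_power: "sgn_rat (x ^ n) = sgn_rat x ^ n"
  by (induction n) (simp_all add: sgn_rat_mult)

lemma sgn_rat_prod: "sgn_rat (\<Prod>i\<in>I. f i) = (\<Prod>i\<in>I. sgn_rat (f i))"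
  by (induction I rule: infinite_finite_induct) (simp_all add: sgn_rat_mult)

lemma sgn_rat_prod_list: "sgn_rat (prod_list xs) = prod_list (map sgn_rat xs)"
  by (induction xs) (simp_all add: sgn_rat_mult)

lemma sgn_rat_of_rat: "sgn_rat (of_rat c) = sgn c"
  by (simp add: sgn_rat_def sgn_if)

lemma poly_prod_list: "poly (prod_list ps) x = prod_list (map (\<lambda>p. poly p x) ps)"
  by (induction ps) simp_all

section \<open>Sign vectors, Tarski queries and the reduction step\<close>

definition signs_at :: "real poly list \<Rightarrow> real \<Rightarrow> sign_vec" where
  "signs_at qs x = map (\<lambda>q. sgn_rat (poly q x)) qs"

definition signs_at_roots :: "real poly \<Rightarrow> real poly list \<Rightarrow> sign_vec set" where
  "signs_at_roots p qs = signs_at qs ` {x. poly p x = 0}"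

text \<open>Each root contributes 1, -1 or 0 to both sides; \<open>p\<close> being nonzero makes the
  set of roots finite, so that sums and cardinalities are genuine.\<close>

lemma tarski_query_eq_sum:
  assumes "p \<noteq> 0"
  shows "of_int (tarski_query p q) = (\<Sum>x | poly p x = 0. sgn_rat (poly q x))"
proof -
  let ?Z = "{x. poly p x = 0}"
  have fin: "finite ?Z" using assms by (rule poly_roots_finite)
  have "(\<Sum>x\<in>?Z. sgn_rat (poly q x)) =
      (\<Sum>x\<in>?Z. if poly q x > 0 then 1 else 0) - (\<Sum>x\<in>?Z. if poly q x < 0 then 1 else 0)"
    unfolding sum_subtractf[symmetric] by (intro sum.cong) (auto simp: sgn_rat_def)
  also have "\<dots> = of_int (tarski_query p q)"
    using fin by (simp add: sum.If_cases tarski_query_def Collect_conj_eq)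
  finally show ?thesis by simp
qed

lemma tarski_query_prod_list:
  assumes "p \<noteq> 0" "\<forall>k\<in>set s. k < length qs"
  shows "of_int (tarski_query p (\<Prod>k\<leftarrow>s. qs ! k)) =
    (\<Sum>x | poly p x = 0. \<Prod>k\<leftarrow>s. signs_at qs x ! k)"
proof -
  have "sgn_rat (poly (\<Prod>k\<leftarrow>s. qs ! k) x) = (\<Prod>k\<leftarrow>s. signs_at qs x ! k)" for x
    using assms(2)
    by (simp add: poly_prod_list sgn_rat_prod_list o_def signs_at_def cong: map_cong)
  then show ?thesis using assms(1) by (simp add: tarski_query_eq_sum)
qed

text \<open>The invariant of the recursion. Only an inclusion is demanded in the last clause, since
  \<open>base\<close> and \<open>combine\<close> list candidates that need not occur at any
  root.\<close>

fun sign_system :: "real poly \<Rightarrow> real poly list \<Rightarrow> sign_data \<Rightarrow> bool" where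
  "sign_system p qs (M, S, \<Sigma>) \<longleftrightarrow>
     length S = length \<Sigma> \<and> M \<in> carrier_mat (length \<Sigma>) (length \<Sigma>) \<and> invertible_mat M \<and>
     distinct \<Sigma> \<and> (\<forall>\<sigma>\<in>set \<Sigma>. length \<sigma> = length qs) \<and>
     (\<forall>s\<in>set S. \<forall>k\<in>set s. k < length qs) \<and>
     (\<forall>i<length \<Sigma>. \<forall>j<length \<Sigma>. M $$ (i, j) = (\<Prod>k\<leftarrow>S ! i. \<Sigma> ! j ! k)) \<and>
     signs_at_roots p qs \<subseteq> set \<Sigma>"

text \<open>Double counting: grouping the roots by their sign vector turns each Tarski query into a
  row of \<open>M\<close> times the vector of root counts, and invertibility of \<open>M\<close>
  recovers the counts.\<close>

lemma matrix_equation: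
  assumes p: "p \<noteq> 0" and sys: "sign_system p qs (M, S, \<Sigma>)"
  shows "the (mat_inverse M) *\<^sub>v vec_of_list (map (\<lambda>s. of_int (tarski_query p (\<Prod>k\<leftarrow>s. qs ! k))) S) =
    vec (length \<Sigma>) (\<lambda>j. of_nat (card {x. poly p x = 0 \<and> signs_at qs x = \<Sigma> ! j}))"
    (is "_ *\<^sub>v ?v = ?w")
proof -
  let ?n = "length \<Sigma>" and ?Z = "{x. poly p x = 0}"
  have M: "M \<in> carrier_mat ?n ?n" and inv: "invertible_mat M" and lS: "length S = ?n"
    using sys by auto
  obtain N where N: "mat_inverse M = Some N" "N \<in> carrier_mat ?n ?n" "N * M = 1\<^sub>m ?n"
    using invertible_mat_obtain_inverse[OF M inv] by metis
  have fin: "finite ?Z" using p by (rule poly_roots_finite)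
  have "M *\<^sub>v ?w = ?v"
  proof (rule eq_vecI)
    fix i assume "i < dim_vec ?v"
    then have i: "i < ?n" using lS by simp
    have "(M *\<^sub>v ?w) $ i =
        (\<Sum>j<?n. M $$ (i, j) * of_nat (card {x. poly p x = 0 \<and> signs_at qs x = \<Sigma> ! j}))"
      using i M by (simp add: scalar_prod_def atLeast0LessThan)
    also have "\<dots> = (\<Sum>j<?n. \<Sum>x\<in>?Z. if signs_at qs x = \<Sigma> ! j then M $$ (i, j) else 0)"
      using fin by (intro sum.cong refl) (simp add: sum.If_cases Collect_conj_eq mult.commute)
    also have "\<dots> = (\<Sum>x\<in>?Z. \<Sum>j<?n. if signs_at qs x = \<Sigma> ! j then M $$ (i, j) else 0)"
      by (rule sum.swap)
    also have "\<dots> = (\<Sum>x\<in>?Z. \<Prod>k\<leftarrow>S ! i. signs_at qs x ! k)"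
    proof (rule sum.cong[OF refl])
      fix x assume "x \<in> ?Z"
      then have "signs_at qs x \<in> set \<Sigma>"
        using sys by (auto simp: signs_at_roots_def)
      then obtain j where j: "j < ?n" "signs_at qs x = \<Sigma> ! j"
        by (metis in_set_conv_nth)
      \<comment> \<open>As \<Sigma> has no repetitions, the root \<open>x\<close> belongs to exactly
        one column.\<close>
      have "(\<Sum>j'<?n. if signs_at qs x = \<Sigma> ! j' then M $$ (i, j') else 0) =
          (\<Sum>j'<?n. if j' = j then M $$ (i, j') else 0)"
        using j sys by (intro sum.cong refl) (auto simp: nth_eq_iff_index_eq)
      also have "\<dots> = (\<Prod>k\<leftarrow>S ! i. signs_at qs x ! k)"
        using i j sys by simp
      finally show "(\<Sum>j'<?n. if signs_at qs x = \<Sigma> ! j' then M $$ (i, j') else 0) = \<dots>" .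
    qed
    also have "\<dots> = of_int (tarski_query p (\<Prod>k\<leftarrow>S ! i. qs ! k))"
      using p sys i by (subst tarski_query_prod_list) auto
    finally show "(M *\<^sub>v ?w) $ i = ?v $ i"
      using i lS by (simp add: vec_of_list_index)
  qed (use M lS in auto)
  then have "N *\<^sub>v ?v = N *\<^sub>v (M *\<^sub>v ?w)" by simp
  also have "\<dots> = (N * M) *\<^sub>v ?w"
    using N M by (intro assoc_mult_mat_vec[symmetric]) auto
  also have "\<dots> = ?w" using N by simp
  finally show ?thesis using N by simp
qed

lemma sign_system_reduce:
  assumes p: "p \<noteq> 0" and sys: "sign_system p qs (M, S, \<Sigma>)"
    and red: "reduce p (qs, (M, S, \<Sigma>)) = (M', S', \<Sigma>')"
  shows "sign_system p qs (M', S', \<Sigma>')" and "set \<Sigma>' = signs_at_roots p qs"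
proof -
  let ?n = "length \<Sigma>"
  define w where
    "w = the (mat_inverse M) *\<^sub>v vec_of_list (map (\<lambda>s. of_int (tarski_query p (\<Prod>k\<leftarrow>s. qs ! k))) S)"
  define J where "J = filter (\<lambda>j. w $ j \<noteq> 0) [0..<dim_col M]"
  define A where "A = mat_of_cols (dim_row M) (map (col M) J)"
  define R where "R = pivot_columns (transpose_mat A)"
  have M': "M' = mat_of_rows (dim_col A) (map (row A) R)" and S': "S' = map ((!) S) R"
    and \<Sigma>': "\<Sigma>' = map ((!) \<Sigma>) J"
    using red by (simp_all add: Let_def w_def J_def A_def R_def)
  have M: "M \<in> carrier_mat ?n ?n" and inv: "invertible_mat M" and lS: "length S = ?n"
    and dist: "distinct \<Sigma>"
    using sys by auto
  have w: "w = vec ?n (\<lambda>j. of_nat (card {x. poly p x = 0 \<and> signs_at qs x = \<Sigma> ! j}))"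
    unfolding w_def using p sys by (rule matrix_equation)
  have J: "distinct J" "set J \<subseteq> {..<?n}"
    using M by (auto simp: J_def)
  have Jn: "J ! j < ?n" if "j < length J" for j using J that by (auto simp: subset_iff)
  \<comment> \<open>The entry of \<open>w\<close> at \<open>j\<close> counts the roots of one sign
    pattern; the root set is finite, so the count is nonzero exactly if such a root exists.\<close>
  have wJ: "j \<in> set J \<longleftrightarrow> j < ?n \<and> \<Sigma> ! j \<in> signs_at_roots p qs" for j
  proof -
    have "finite {x. poly p x = 0 \<and> signs_at qs x = \<Sigma> ! j}"
      by (rule finite_subset[OF _ poly_roots_finite[OF p]]) auto
    moreover have "signs_at_roots p qs = {\<sigma>. \<exists>x. poly p x = 0 \<and> signs_at qs x = \<sigma>}"
      by (auto simp: signs_at_roots_def)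
    ultimately show ?thesis using M by (auto simp: J_def w)
  qed
  show set\<Sigma>': "set \<Sigma>' = signs_at_roots p qs"
  proof
    show "set \<Sigma>' \<subseteq> signs_at_roots p qs"
      using wJ by (auto simp: \<Sigma>')
    show "signs_at_roots p qs \<subseteq> set \<Sigma>'"
    proof
      fix \<sigma> assume \<sigma>: "\<sigma> \<in> signs_at_roots p qs"
      then obtain j where "j < ?n" "\<Sigma> ! j = \<sigma>"
        using sys by (auto simp: subset_iff in_set_conv_nth)
      then show "\<sigma> \<in> set \<Sigma>'" using wJ[of j] \<sigma> by (auto simp: \<Sigma>')
    qed
  qed
  obtain N where N: "N \<in> carrier_mat ?n ?n" "N * M = 1\<^sub>m ?n"
    using invertible_mat_obtain_inverse[OF M inv] by metis
  have A: "A \<in> carrier_mat ?n (length J)" using M by (auto simp: A_def)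
  have L: "mat_of_rows ?n (map (row N) J) \<in> carrier_mat (length J) ?n"
    using mat_of_rows_carrier(1)[of ?n "map (row N) J"] by simp
  \<comment> \<open>The rows of the inverse \<open>N\<close> with index in \<open>J\<close> witness
    the independence of the kept columns.\<close>
  have LA: "mat_of_rows ?n (map (row N) J) * A = 1\<^sub>m (length J)"
    using columns_left_inverse[OF M N J] M by (simp add: A_def)
  note R = pivot_columns_left_invertible[OF A L LA, folded R_def]
  have Rn: "R ! i < ?n" if "i < length J" for i using R(1,2) that by (auto simp: subset_iff)
  \<comment> \<open>Every entry of the reduced matrix is an entry of \<open>M\<close>, so the
    product formula is inherited.\<close>
  have "M' $$ (i, j) = (\<Prod>k\<leftarrow>S' ! i. \<Sigma>' ! j ! k)" if "i < length J" "j < length J" for i j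
  proof -
    have "M' $$ (i, j) = M $$ (R ! i, J ! j)"
      using that A R(1) Rn[OF that(1)] Jn[OF that(2)] M by (simp add: M' mat_of_rows_index A_def mat_of_cols_index)
    then show ?thesis using sys that Rn Jn R(1) by (simp add: S' \<Sigma>')
  qed
  moreover have "distinct \<Sigma>'"
    using J dist by (auto simp: \<Sigma>' distinct_map intro!: inj_on_nth)
  moreover have "\<forall>s\<in>set S'. \<forall>k\<in>set s. k < length qs"
    using sys R(2) lS by (auto simp: S' subset_iff)
  moreover have "\<forall>\<sigma>\<in>signs_at_roots p qs. length \<sigma> = length qs"
    by (auto simp: signs_at_roots_def signs_at_def)
  moreover have "invertible_mat M'" using R(3) A by (simp add: M')
  moreover have "M' \<in> carrier_mat (length J) (length J)"
    using A R(1) by (intro carrier_matI) (auto simp: M')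
  ultimately show "sign_system p qs (M', S', \<Sigma>')"
    using R(1) set\<Sigma>' by (simp add: S') (simp add: \<Sigma>')
qed

section \<open>The combination step\<close>

lemma nth_list_product:
  assumes "i < length xs * length ys"
  shows "[f x y. x \<leftarrow> xs, y \<leftarrow> ys] ! i = f (xs ! (i div length ys)) (ys ! (i mod length ys))"
  using assms
proof (induction xs arbitrary: i)
  case (Cons x xs)
  have ys: "length ys > 0" using Cons.prems by (cases ys) auto
  show ?case
  proof (cases "i < length ys")
    case False
    then have "i - length ys < length xs * length ys" using Cons.prems by simp
    note IH = Cons.IH[OF this]
    have "i div length ys = Suc ((i - length ys) div length ys)"
      "i mod length ys = (i - length ys) mod length ys"
      using False ys by (simp_all add: le_div_geq le_mod_geq)
    then show ?thesis using False IH by (simp add: nth_append)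
  qed (simp add: nth_append)
qed simp

lemma length_list_product: "length [f x y. x \<leftarrow> xs, y \<leftarrow> ys] = length xs * length ys"
  by (induction xs) simp_all

lemma set_list_product: "set [f x y. x \<leftarrow> xs, y \<leftarrow> ys] = (\<lambda>(x, y). f x y) ` (set xs \<times> set ys)"
  by auto

lemma signs_at_append: "signs_at (qs1 @ qs2) x = signs_at qs1 x @ signs_at qs2 x"
  by (simp add: signs_at_def)

lemma sign_system_combine:
  assumes sys1: "sign_system p qs1 (M1, S1, \<Sigma>1)" and sys2: "sign_system p qs2 (M2, S2, \<Sigma>2)"
    and comb: "combine (qs1, (M1, S1, \<Sigma>1)) (qs2, (M2, S2, \<Sigma>2)) = (qs, (M, S, \<Sigma>))"
  shows "sign_system p qs (M, S, \<Sigma>)"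
proof -
  let ?n1 = "length \<Sigma>1" and ?n2 = "length \<Sigma>2"
  have qs: "qs = qs1 @ qs2" and M: "M = kronecker_product M1 M2"
    and S: "S = [s1 @ map (\<lambda>k. k + length qs1) s2. s1 \<leftarrow> S1, s2 \<leftarrow> S2]"
    and \<Sigma>: "\<Sigma> = [\<sigma>1 @ \<sigma>2. \<sigma>1 \<leftarrow> \<Sigma>1, \<sigma>2 \<leftarrow> \<Sigma>2]"
    using comb by auto
  have M1: "M1 \<in> carrier_mat ?n1 ?n1" and M2: "M2 \<in> carrier_mat ?n2 ?n2"
    using sys1 sys2 by auto
  have lens: "length S1 = ?n1" "length S2 = ?n2" using sys1 sys2 by auto
  have l\<Sigma>: "length \<Sigma> = ?n1 * ?n2" unfolding \<Sigma> by (rule length_list_product)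
  have lS: "length S = ?n1 * ?n2" unfolding S length_list_product lens ..
  \<comment> \<open>All sign vectors in the first list have the same length, so concatenation is
    injective; \<Sigma> then has as many distinct entries as its length allows.\<close>
  have card: "card (set \<Sigma>) = ?n1 * ?n2"
  proof -
    have "inj_on (\<lambda>(\<sigma>1, \<sigma>2). \<sigma>1 @ \<sigma>2) (set \<Sigma>1 \<times> set \<Sigma>2)"
      using sys1 by (auto simp: inj_on_def)
    then show ?thesis
      unfolding \<Sigma> set_list_product using sys1 sys2
      by (simp add: card_image card_cartesian_product distinct_card)
  qed
  then have "distinct \<Sigma>" using l\<Sigma> card_distinct by metis
  moreover have "\<forall>\<sigma>\<in>set \<Sigma>. length \<sigma> = length qs"
    using sys1 sys2 by (auto simp: \<Sigma> qs)
  moreover have "\<forall>s\<in>set S. \<forall>k\<in>set s. k < length qs"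
    using sys1 sys2 by (fastforce simp: S qs)
  moreover have "M $$ (i, j) = (\<Prod>k\<leftarrow>S ! i. \<Sigma> ! j ! k)" if i: "i < ?n1 * ?n2" and j: "j < ?n1 * ?n2" for i j
  proof -
    note dm = div_mod_less_mult[OF i] div_mod_less_mult[OF j]
    define i1 i2 j1 j2 where ij: "i1 = i div ?n2" "i2 = i mod ?n2" "j1 = j div ?n2" "j2 = j mod ?n2"
    have bnd: "i1 < ?n1" "i2 < ?n2" "j1 < ?n1" "j2 < ?n2" using dm by (simp_all add: ij)
    \<comment> \<open>The comprehension runs through its second list fastest, so entry
      \<open>i\<close> pairs quotient and remainder of \<open>i\<close>, as in the Kronecker
      product.\<close>
    have S_i: "S ! i = S1 ! i1 @ map (\<lambda>k. k + length qs1) (S2 ! i2)"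
      unfolding S using i by (subst nth_list_product) (simp_all add: lens ij)
    have \<Sigma>_j: "\<Sigma> ! j = \<Sigma>1 ! j1 @ \<Sigma>2 ! j2"
      unfolding \<Sigma> using j by (subst nth_list_product) (simp_all add: ij)
    have len: "length (\<Sigma>1 ! j1) = length qs1" using sys1 bnd by simp
    have k1: "k < length qs1" if "k \<in> set (S1 ! i1)" for k
      using sys1 that bnd by (auto simp: lens)
    have "M $$ (i, j) = M1 $$ (i1, j1) * M2 $$ (i2, j2)"
      using i j M1 M2 by (simp add: M kronecker_product_def ij)
    also have "\<dots> = (\<Prod>k\<leftarrow>S1 ! i1. \<Sigma>1 ! j1 ! k) * (\<Prod>k\<leftarrow>S2 ! i2. \<Sigma>2 ! j2 ! k)"
      using sys1 sys2 bnd by simp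
    \<comment> \<open>Unshifted indices stay below \<open>length qs1\<close> and read the first half
      of the concatenated vector; the shifted ones read the second half.\<close>
    also have "map (\<lambda>k. \<Sigma>1 ! j1 ! k) (S1 ! i1) = map (\<lambda>k. (\<Sigma> ! j) ! k) (S1 ! i1)"
      using k1 len by (simp add: \<Sigma>_j nth_append)
    also have "map (\<lambda>k. \<Sigma>2 ! j2 ! k) (S2 ! i2) =
        map (\<lambda>k. (\<Sigma> ! j) ! k) (map (\<lambda>k. k + length qs1) (S2 ! i2))"
      using len by (simp add: \<Sigma>_j nth_append)
    finally show ?thesis by (simp add: S_i)
  qed
  moreover have "invertible_mat M"
    unfolding M using sys1 sys2 by (intro invertible_kronecker_product[OF M1 M2]) auto
  moreover have "M \<in> carrier_mat (?n1 * ?n2) (?n1 * ?n2)"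
    using M1 M2 by (intro carrier_matI) (auto simp: M)
  moreover have "signs_at_roots p qs \<subseteq> set \<Sigma>"
  proof
    fix \<sigma> assume "\<sigma> \<in> signs_at_roots p qs"
    then obtain x where x: "poly p x = 0" "\<sigma> = signs_at qs1 x @ signs_at qs2 x"
      by (auto simp: signs_at_roots_def qs signs_at_append)
    then have "signs_at qs1 x \<in> set \<Sigma>1" "signs_at qs2 x \<in> set \<Sigma>2"
      using sys1 sys2 by (auto simp: signs_at_roots_def)
    then show "\<sigma> \<in> set \<Sigma>" by (auto simp: \<Sigma> x)
  qed
  ultimately show ?thesis by (simp add: l\<Sigma> lS)
qed

section \<open>The base case and the recursion\<close>

lemma sign_system_base:
  assumes "\<And>x. poly p x = 0 \<Longrightarrow> poly q x \<noteq> 0"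
  shows "sign_system p [q] base"
proof -
  let ?M = "mat_of_rows_list 2 [[1, 1], [1, -1]] :: rat mat"
  \<comment> \<open>The explicit inverse of the base matrix.\<close>
  let ?N = "mat_of_rows_list 2 [[1/2, 1/2], [1/2, -1/2]] :: rat mat"
  have less2: "i < 2 \<longleftrightarrow> i = 0 \<or> i = Suc 0" for i :: nat by auto
  have "?N * ?M = 1\<^sub>m 2"
    by (rule eq_matI) (auto simp: less2 mat_of_rows_list_def scalar_prod_def)
  then have "invertible_mat ?M"
    by (intro invertible_mat_leftI[of _ 2 ?N]) (auto simp: mat_of_rows_list_def)
  \<comment> \<open>Without common roots the sign 0 cannot occur, so the two candidates of
    \<open>base\<close> suffice.\<close>
  moreover have "signs_at [q] x \<in> {[1], [-1]}" if "poly p x = 0" for x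
    using assms[OF that] by (auto simp: signs_at_def sgn_rat_def)
  ultimately show ?thesis
    by (auto simp: base_def less2 mat_of_rows_list_def signs_at_roots_def numeral_2_eq_2 less_Suc_eq)
qed

text \<open>The base case uses the absence of common roots. The empty list, for which
  \<open>calc_data\<close> works with \<open>[1]\<close> instead, is treated in
  \<open>set_FCSR\<close>.\<close>

lemma sign_system_calc_data:
  assumes "p \<noteq> 0" "\<And>q x. q \<in> set qs \<Longrightarrow> poly p x = 0 \<Longrightarrow> poly q x \<noteq> 0" "qs \<noteq> []"
  shows "sign_system p qs (calc_data p qs) \<and> set (FCSR p qs) = signs_at_roots p qs"
  using assms
proof (induction p qs rule: calc_data.induct)
  case (1 p qs)
  \<comment> \<open>Both remaining cases end in \<open>reduce\<close>, so it suffices to provide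
    data \<open>T\<close> satisfying the invariant.\<close>
  have red: ?case
    if "sign_system p qs T" "calc_data p qs = reduce p (qs, T)" for T
  proof -
    obtain M S \<Sigma> where T: "T = (M, S, \<Sigma>)" by (cases T)
    obtain M' S' \<Sigma>' where T': "reduce p (qs, (M, S, \<Sigma>)) = (M', S', \<Sigma>')"
      by (cases "reduce p (qs, (M, S, \<Sigma>))")
    show ?thesis
      using sign_system_reduce[OF 1(3) that(1)[unfolded T] T'] that(2)
      by (simp add: T T' FCSR_def del: sign_system.simps reduce.simps)
  qed
  show ?case
  proof (cases "length qs = 1")
    case True
    then obtain q where q: "qs = [q]" by (auto simp: length_Suc_conv)
    show ?thesis
    proof (rule red)
      show "sign_system p qs base" using 1(4) by (auto simp: q intro!: sign_system_base)
      show "calc_data p qs = reduce p (qs, base)" by (simp add: q calc_data.simps)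
    qed
  next
    case False
    define qs1 qs2 where q12: "qs1 = take (length qs div 2) qs" "qs2 = drop (length qs div 2) qs"
    have len: "length qs \<noteq> 0" using 1(5) by simp
    \<comment> \<open>With at least two entries both halves are nonempty, as the induction
      hypotheses require.\<close>
    have "2 \<le> length qs" using False len by linarith
    then have ne: "qs1 \<noteq> []" "qs2 \<noteq> []"
      by (auto simp: q12 Suc_le_eq)
    have qs: "qs = qs1 @ qs2" by (simp add: q12)
    have IH1: "sign_system p qs1 (calc_data p qs1)"
      using 1(1)[OF len False q12] 1(3,4) ne by (auto simp: qs)
    have IH2: "sign_system p qs2 (calc_data p qs2)"
      using 1(2)[OF len False q12] 1(3,4) ne by (auto simp: qs)
    obtain M1 S1 \<Sigma>1 where T1: "calc_data p qs1 = (M1, S1, \<Sigma>1)" by (cases "calc_data p qs1")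
    obtain M2 S2 \<Sigma>2 where T2: "calc_data p qs2 = (M2, S2, \<Sigma>2)" by (cases "calc_data p qs2")
    obtain qs' M S \<Sigma> where T: "combine (qs1, (M1, S1, \<Sigma>1)) (qs2, (M2, S2, \<Sigma>2)) = (qs', M, S, \<Sigma>)"
      by (cases "combine (qs1, (M1, S1, \<Sigma>1)) (qs2, (M2, S2, \<Sigma>2))")
    have qs': "qs' = qs" using T by (simp add: qs)
    show ?thesis
    proof (rule red)
      show "sign_system p qs (M, S, \<Sigma>)"
        using sign_system_combine[OF IH1[unfolded T1] IH2[unfolded T2] T] unfolding qs' .
      show "calc_data p qs = reduce p (qs, (M, S, \<Sigma>))"
        using False len T1 T2 T unfolding qs'
        by (subst calc_data.simps) (simp add: q12 Let_def del: combine.simps reduce.simps)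
    qed
  qed
qed

lemma set_FCSR:
  assumes p: "p \<noteq> 0" and "\<And>q x. q \<in> set qs \<Longrightarrow> poly p x = 0 \<Longrightarrow> poly q x \<noteq> 0"
  shows "set (FCSR p qs) = signs_at_roots p qs"
proof (cases "qs = []")
  case True
  have "sign_system p [1] base" by (rule sign_system_base) simp
  then have sys: "sign_system p [1] (fst base, fst (snd base), snd (snd base))" by simp
  obtain M S \<Sigma> where T: "reduce p ([1], fst base, fst (snd base), snd (snd base)) = (M, S, \<Sigma>)"
    by (cases "reduce p ([1], fst base, fst (snd base), snd (snd base))")
  have "FCSR p qs = map tl \<Sigma>"
    using T unfolding True by (simp add: FCSR_def calc_data.simps[of p "[]"] del: reduce.simps)
  \<comment> \<open>The constant \<open>1\<close> contributes the single entry 1 at every root;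
    deleting it leaves the empty vector exactly if \<open>p\<close> has a root.\<close>
  then have "set (FCSR p qs) = tl ` signs_at_roots p [1]"
    using sign_system_reduce(2)[OF p sys T] by simp
  also have "\<dots> = signs_at_roots p qs"
    by (simp add: True signs_at_roots_def signs_at_def image_image)
  finally show ?thesis .
next
  case False
  then show ?thesis using sign_system_calc_data assms by blast
qed

section \<open>Sample points\<close>

lemma real_poly_mult: "real_poly (p * q) = real_poly p * real_poly q"
  by (rule poly_eqI) (simp add: coeff_map_poly coeff_mult of_rat_sum of_rat_mult)

lemma real_poly_add: "real_poly (p + q) = real_poly p + real_poly q"
  by (rule poly_eqI) (simp add: coeff_map_poly of_rat_add)

lemma real_poly_prod_list: "real_poly (prod_list ps) = prod_list (map real_poly ps)"
  by (induction ps) (simp_all add: real_poly_mult)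

lemma real_poly_power: "real_poly (p ^ n) = real_poly p ^ n"
  by (induction n) (simp_all add: real_poly_mult)

lemma real_poly_prod: "real_poly (\<Prod>i\<in>I. f i) = (\<Prod>i\<in>I. real_poly (f i))"
  by (induction I rule: infinite_finite_induct) (simp_all add: real_poly_mult)

lemma real_poly_smult: "real_poly (Polynomial.smult c p) = Polynomial.smult (of_rat c) (real_poly p)"
  by (rule poly_eqI) (simp add: coeff_map_poly of_rat_mult)

lemma real_poly_pderiv: "real_poly (pderiv p) = pderiv (real_poly p)"
  by (rule poly_eqI) (simp add: coeff_map_poly coeff_pderiv of_rat_mult of_rat_add)

lemma real_poly_eq_0_iff [simp]: "real_poly p = 0 \<longleftrightarrow> p = 0"
  by (simp add: map_poly_eq_0_iff)

text \<open>A rational Bezout identity carries over to the reals; at a common root it would read 0 =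
  1.\<close>

lemma coprime_real_poly_no_common_root:
  assumes "coprime p q" "poly (real_poly p) x = 0"
  shows "poly (real_poly q) x \<noteq> 0"
proof
  assume q: "poly (real_poly q) x = 0"
  define a b where ab: "a = fst (bezout_coefficients p q)" "b = snd (bezout_coefficients p q)"
  have "a * p + b * q = 1"
    using assms(1) bezout_coefficients_fst_snd[of p q] by (simp add: ab)
  then have "poly (real_poly (a * p + b * q)) x = 1" by simp
  then show False using assms(2) q by (simp add: real_poly_add real_poly_mult)
qed

lemma squarefree_prod_list:
  assumes "\<forall>q\<in>set qs. squarefree q"
    and "\<forall>i<length qs. \<forall>j<length qs. i \<noteq> j \<longrightarrow> coprime (qs ! i) (qs ! j)"
  shows "squarefree (prod_list qs :: 'a::factorial_semiring_gcd)"
  using assms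
proof (induction qs)
  case (Cons q qs)
  have "coprime q q'" if q': "q' \<in> set qs" for q'
  proof -
    obtain i where "i < length qs" "q' = qs ! i" using q' by (auto simp: in_set_conv_nth)
    then show ?thesis using Cons.prems(2)[rule_format, of 0 "Suc i"] by simp
  qed
  then have "coprime q (prod_list qs)"
    by (induction qs) auto
  moreover have "squarefree (prod_list qs)"
  proof (rule Cons.IH)
    show "\<forall>i<length qs. \<forall>j<length qs. i \<noteq> j \<longrightarrow> coprime (qs ! i) (qs ! j)"
      using Cons.prems(2) by (metis Suc_less_eq length_Cons nat.inject nth_Cons_Suc)
  qed (use Cons.prems in auto)
  ultimately show ?case using Cons.prems(1) by (simp add: squarefree_mult_coprime)
qed simp

text \<open>If a prime \<open>p\<close> divides both \<open>f = p * g\<close> and its derivative,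
  then it divides \<open>g * pderiv p\<close>. It cannot divide \<open>g\<close> because
  \<open>f\<close> is squarefree, nor \<open>pderiv p\<close>, which in characteristic 0 is nonzero
  of smaller degree.\<close>

lemma squarefree_coprime_pderiv:
  fixes f :: "'a::{field_gcd, field_char_0} poly"
  assumes "squarefree f"
  shows "coprime f (pderiv f)"
proof (rule ccontr)
  have f0: "f \<noteq> 0" using assms by auto
  assume "\<not> coprime f (pderiv f)"
  then have "\<not> is_unit (gcd f (pderiv f))" by (simp only: is_unit_gcd not_False_eq_True)
  moreover have "gcd f (pderiv f) \<noteq> 0" using f0 by simp
  ultimately obtain p where p: "prime p" "p dvd f" "p dvd pderiv f"
    using prime_divisor_exists[of "gcd f (pderiv f)"] by (metis gcd_greatest_iff)
  obtain g where g: "f = p * g" using p(2) by auto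
  have "p dvd p * pderiv g + g * pderiv p" using p(3) unfolding g pderiv_mult .
  then have "p dvd g * pderiv p" using dvd_add_right_iff[of p "p * pderiv g"] by simp
  moreover have "\<not> p dvd g"
  proof
    assume "p dvd g"
    then have "p\<^sup>2 dvd f" by (auto simp: g power2_eq_square)
    then show False using assms p(1) by (auto simp: squarefree_def)
  qed
  ultimately have "p dvd pderiv p" using p(1) by (simp add: prime_dvd_mult_iff)
  moreover have "\<not> p dvd pderiv p"
  proof (rule not_dvd_pderiv)
    show "degree p \<noteq> 0"
      using p(1) by (metis is_unit_iff_degree not_prime_unit not_prime_0)
  qed
  ultimately show False by blast
qed

section \<open>Constant signs on root-free intervals\<close>

lemma sgn_rat_poly_const:
  assumes "x \<le> y" "\<And>z. x \<le> z \<Longrightarrow> z \<le> y \<Longrightarrow> poly q z \<noteq> 0"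
  shows "sgn_rat (poly q x) = sgn_rat (poly q y)"
proof (rule ccontr)
  assume ne: "sgn_rat (poly q x) \<noteq> sgn_rat (poly q y)"
  have nz: "poly q x \<noteq> 0" "poly q y \<noteq> 0" using assms by auto
  have "x < y" using assms(1) ne by (cases "x = y") auto
  moreover have "poly q x * poly q y < 0"
    using ne nz by (auto simp: sgn_rat_def mult_less_0_iff split: if_splits)
  ultimately obtain z where "x < z" "z < y" "poly q z = 0"
    using poly_IVT[of x y q] by blast
  then show False using assms(2)[of z] by simp
qed

lemma signs_at_prod_list_const:
  assumes "\<And>z. min x y \<le> z \<Longrightarrow> z \<le> max x y \<Longrightarrow> poly (prod_list qs) z \<noteq> 0"
  shows "signs_at qs x = signs_at qs y"
  unfolding signs_at_def
proof (rule map_cong[OF refl])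
  fix q assume q: "q \<in> set qs"
  have nz: "poly q z \<noteq> 0" if "min x y \<le> z" "z \<le> max x y" for z
    using assms[OF that] q by (auto simp: poly_prod_list prod_list_zero_iff)
  show "sgn_rat (poly q x) = sgn_rat (poly q y)"
  proof (cases "x \<le> y")
    case True
    show ?thesis using True nz by (intro sgn_rat_poly_const) auto
  next
    case False
    show ?thesis using False nz by (intro sgn_rat_poly_const[symmetric]) auto
  qed
qed

text \<open>If no root lies to the left of \<open>x\<close>, then \<open>-B\<close> serves as
  \<open>y\<close>; if none lies to the right, \<open>B\<close> does. Otherwise \<open>x\<close>
  lies between two neighbouring roots, and Rolle's theorem yields a critical point there.\<close>

lemma poly_root_free_or_pderiv_root:
  fixes f :: "real poly"
  assumes "f \<noteq> 0" and bound: "\<And>z. poly f z = 0 \<Longrightarrow> \<bar>z\<bar> < B" and x: "poly f x \<noteq> 0"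
  obtains y where "y = B \<or> y = -B \<or> (poly (pderiv f) y = 0 \<and> pderiv f \<noteq> 0)"
    "\<And>z. min x y \<le> z \<Longrightarrow> z \<le> max x y \<Longrightarrow> poly f z \<noteq> 0"
proof -
  define lo where "lo = {z. poly f z = 0 \<and> z < x}"
  define hi where "hi = {z. poly f z = 0 \<and> z > x}"
  have fin: "finite lo" "finite hi"
    using poly_roots_finite[OF assms(1)] by (auto simp: lo_def hi_def intro: finite_subset)
  have roots: "z \<in> lo \<or> z \<in> hi" if "poly f z = 0" for z
    using that x by (cases z x rule: linorder_cases) (auto simp: lo_def hi_def)
  consider "lo = {}" | "hi = {}" | "lo \<noteq> {}" "hi \<noteq> {}" by blast
  then show ?thesis
  proof cases
    case 1
    show ?thesis
    proof (rule that[of "-B"])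
      fix z assume z: "min x (- B) \<le> z" "z \<le> max x (- B)"
      show "poly f z \<noteq> 0"
      proof
        assume 0: "poly f z = 0"
        then have "z > x" using roots 1 by (auto simp: hi_def)
        then show False using bound[OF 0] z by auto
      qed
    qed simp
  next
    case 2
    show ?thesis
    proof (rule that[of B])
      fix z assume z: "min x B \<le> z" "z \<le> max x B"
      show "poly f z \<noteq> 0"
      proof
        assume 0: "poly f z = 0"
        then have "z < x" using roots 2 by (auto simp: lo_def)
        then show False using bound[OF 0] z by auto
      qed
    qed simp
  next
    case 3
    define a b where ab: "a = Max lo" "b = Min hi"
    have "a \<in> lo" "b \<in> hi" using 3 fin by (simp_all add: ab)
    then have a: "poly f a = 0" "a < x" and b: "poly f b = 0" "x < b"
      by (auto simp: lo_def hi_def)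
    have gap: "poly f z \<noteq> 0" if "a < z" "z < b" for z
    proof
      assume "poly f z = 0"
      then have "z \<le> a \<or> b \<le> z" using roots fin unfolding ab by (meson Max_ge Min_le)
      then show False using that by auto
    qed
    obtain y where y: "a < y" "y < b" "poly (pderiv f) y = 0"
      using poly_MVT[of a b f] a b by auto
    \<comment> \<open>A constant \<open>f\<close> with a root would be zero. The fact matters
      because \<open>sample_poly\<close> contains the derivative only if it is nonzero.\<close>
    have "pderiv f \<noteq> 0"
    proof
      assume "pderiv f = 0"
      then obtain c where "f = [:c:]" using pderiv_eq_0_iff degree_eq_zeroE by metis
      then show False using a assms(1) by simp
    qed
    with y show ?thesis using gap a b by (intro that[of y]) auto
  qed
qed

lemma remove_at_eq_insert:
  "i < length xs \<Longrightarrow> insert_at i (xs ! i) (remove_at i xs) = xs"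
  by (simp add: insert_at_def remove_at_def id_take_nth_drop[symmetric])

lemma map_remove_at: "map f (remove_at i xs) = remove_at i (map f xs)"
  by (simp add: remove_at_def take_map drop_map)

lemma set_remove_at: "q \<in> set (remove_at i xs) \<Longrightarrow> \<exists>j<length xs. j \<noteq> i \<and> q = xs ! j"
proof -
  assume "q \<in> set (remove_at i xs)"
  then consider "q \<in> set (take i xs)" | "q \<in> set (drop (Suc i) xs)"
    by (auto simp: remove_at_def)
  then show ?thesis
  proof cases
    case 1
    then show ?thesis by (auto simp: in_set_conv_nth)
  next
    case 2
    then obtain k where "k < length xs - Suc i" "q = xs ! (Suc i + k)"
      by (auto simp: in_set_conv_nth)
    then show ?thesis by (intro exI[of _ "Suc i + k"]) auto
  qed
qed

section \<open>Sign vectors of the factors\<close>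

context
  fixes crb :: "rat poly \<Rightarrow> nat" and Q :: "rat poly list"
  assumes crb: "root_bound_procedure crb"
    and sqf: "\<forall>q\<in>set Q. squarefree q"
    and coprime: "\<forall>i<length Q. \<forall>j<length Q. i \<noteq> j \<longrightarrow> coprime (Q ! i) (Q ! j)"
begin

lemma squarefree_prod_factors: "squarefree (prod_list Q)"
  using sqf coprime by (rule squarefree_prod_list)

lemma prod_factors_nonzero: "prod_list Q \<noteq> 0"
  using squarefree_prod_factors not_squarefree_0 by metis

lemma sample_poly_nonzero: "sample_poly crb (prod_list Q) \<noteq> 0"
  unfolding sample_poly_def mult_eq_0_iff by auto

lemma poly_sample_poly_eq_0_iff:
  "poly (real_poly (sample_poly crb (prod_list Q))) y = 0 \<longleftrightarrow>
     y = real (crb (prod_list Q)) \<or> y = - real (crb (prod_list Q)) \<or>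
     (pderiv (prod_list Q) \<noteq> 0 \<and> poly (pderiv (real_poly (prod_list Q))) y = 0)"
  unfolding sample_poly_def real_poly_mult poly_mult mult_eq_0_iff
  by (auto simp: real_poly_pderiv map_poly_pCons of_rat_minus)

text \<open>The product has no root at the two bound points, as the bound is strict, and none in
  common with its derivative, as it is squarefree.\<close>

lemma sample_poly_root_imp_factor_nonzero:
  assumes "poly (real_poly (sample_poly crb (prod_list Q))) y = 0" "q \<in> set Q"
  shows "poly (real_poly q) y \<noteq> 0"
proof -
  let ?f = "prod_list Q"
  have "poly (real_poly ?f) y \<noteq> 0"
  proof
    assume 0: "poly (real_poly ?f) y = 0"
    then have "\<bar>y\<bar> < real (crb ?f)"
      using crb prod_factors_nonzero unfolding root_bound_procedure_def by blast
    then have "poly (real_poly (pderiv ?f)) y = 0"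
      using assms(1) unfolding poly_sample_poly_eq_0_iff by (auto simp: real_poly_pderiv)
    then show False
      using coprime_real_poly_no_common_root[OF squarefree_coprime_pderiv[OF squarefree_prod_factors] 0]
      by simp
  qed
  then show ?thesis
    using assms(2) by (auto simp: real_poly_prod_list poly_prod_list prod_list_zero_iff)
qed

lemma set_factor_signs: "set (factor_signs crb Q) = range (signs_at (map real_poly Q))"
proof -
  let ?s = "signs_at (map real_poly Q)" and ?p = "sample_poly crb (prod_list Q)"
  \<comment> \<open>Pairwise coprimality excludes common roots, so \<open>set_FCSR\<close> applies;
    at a root of \<open>Q ! i\<close> the inserted \<open>0\<close> is the sign of
    \<open>Q ! i\<close> itself.\<close>
  have at_factor: "insert_at i 0 ` set (FCSR (real_poly (Q ! i)) (map real_poly (remove_at i Q))) =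
      ?s ` {x. poly (real_poly (Q ! i)) x = 0}" if i: "i < length Q" for i
  proof -
    have "Q ! i \<noteq> 0" using sqf i by (metis not_squarefree_0 nth_mem)
    moreover have "poly q x \<noteq> 0"
      if q: "q \<in> set (map real_poly (remove_at i Q))" and x: "poly (real_poly (Q ! i)) x = 0" for q x
      using q coprime i coprime_real_poly_no_common_root[OF _ x] by (auto dest!: set_remove_at)
    ultimately have "set (FCSR (real_poly (Q ! i)) (map real_poly (remove_at i Q))) =
        signs_at_roots (real_poly (Q ! i)) (map real_poly (remove_at i Q))"
      by (intro set_FCSR) auto
    moreover have "insert_at i 0 (signs_at (map real_poly (remove_at i Q)) x) = ?s x"
      if "poly (real_poly (Q ! i)) x = 0" for x
      using remove_at_eq_insert[of i "?s x"] that i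
      by (simp add: signs_at_def map_remove_at)
    ultimately show ?thesis by (force simp: signs_at_roots_def image_image)
  qed
  have at_sample: "set (FCSR (real_poly ?p) (map real_poly Q)) = ?s ` {x. poly (real_poly ?p) x = 0}"
    using sample_poly_nonzero sample_poly_root_imp_factor_nonzero
    by (subst set_FCSR) (auto simp: signs_at_roots_def)
  have "?s x \<in> set (factor_signs crb Q)" for x
  proof (cases "poly (real_poly (prod_list Q)) x = 0")
    case True
    then obtain i where "i < length Q" "poly (real_poly (Q ! i)) x = 0"
      by (auto simp: real_poly_prod_list poly_prod_list prod_list_zero_iff in_set_conv_nth)
    then have "?s x \<in> insert_at i 0 ` set (FCSR (real_poly (Q ! i)) (map real_poly (remove_at i Q)))"
      by (simp add: at_factor)
    then show ?thesis using \<open>i < length Q\<close> by (auto simp: factor_signs_def)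
  next
    case False
    have bound: "\<bar>z\<bar> < real (crb (prod_list Q))" if "poly (real_poly (prod_list Q)) z = 0" for z
      using that crb prod_factors_nonzero unfolding root_bound_procedure_def by blast
    have "real_poly (prod_list Q) \<noteq> 0" using prod_factors_nonzero by simp
    \<comment> \<open>A root \<open>y\<close> of the sample polynomial not separated from
      \<open>x\<close> by any root of the product has the same signs as \<open>x\<close>.\<close>
    from poly_root_free_or_pderiv_root[OF this bound False]
    obtain y where y: "y = real (crb (prod_list Q)) \<or> y = - real (crb (prod_list Q)) \<or>
        poly (pderiv (real_poly (prod_list Q))) y = 0 \<and> pderiv (real_poly (prod_list Q)) \<noteq> 0"
      and gap: "\<And>z. min x y \<le> z \<Longrightarrow> z \<le> max x y \<Longrightarrow> poly (real_poly (prod_list Q)) z \<noteq> 0"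
      by blast
    have "poly (real_poly ?p) y = 0"
      using y unfolding poly_sample_poly_eq_0_iff
      by (auto simp: real_poly_pderiv[symmetric])
    moreover have "?s x = ?s y"
      using gap by (intro signs_at_prod_list_const) (simp add: real_poly_prod_list)
    ultimately show ?thesis by (auto simp: factor_signs_def at_sample)
  qed
  moreover have "set (factor_signs crb Q) \<subseteq> range ?s"
    using at_factor at_sample by (fastforce simp: factor_signs_def)
  ultimately show ?thesis by auto
qed

end

section \<open>Signs of the input polynomials and truth of formulas\<close>

lemma set_find_consistent_signs:
  assumes "factorization_procedure factorize" "root_bound_procedure crb"
  shows "set (find_consistent_signs factorize crb G) = range (signs_at (map real_poly G))"
proof -
  obtain Q c d where F: "factorize G = (Q, c, d)" by (cases "factorize G")
  then have fac: "is_factorization G (Q, c, d)"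
    using assms(1) unfolding factorization_procedure_def by metis
  define recover where
    "recover \<tau> = map (\<lambda>j. sgn (c j) * (\<Prod>i<length Q. (\<tau> ! i) ^ d j i)) [0..<length G]" for \<tau> :: sign_vec
  \<comment> \<open>Signs are multiplicative, so they can be recovered through the factorization;
    \<open>0 ^ 0 = 1\<close> is the right value for a vanishing factor with exponent 0.\<close>
  have "recover (signs_at (map real_poly Q) x) = signs_at (map real_poly G) x" for x
  proof (rule nth_equalityI)
    fix j assume "j < length (recover (signs_at (map real_poly Q) x))"
    then have j: "j < length G" by (simp add: recover_def)
    have "sgn_rat (poly (real_poly (G ! j)) x) =
        sgn_rat (poly (real_poly (Polynomial.smult (c j) (\<Prod>i<length Q. (Q ! i) ^ d j i))) x)"
      using fac j by auto
    also have "\<dots> = sgn (c j) * (\<Prod>i<length Q. sgn_rat (poly (real_poly (Q ! i)) x) ^ d j i)"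
      by (simp add: real_poly_smult real_poly_prod real_poly_power poly_prod sgn_rat_mult
          sgn_rat_prod sgn_rat_power sgn_rat_of_rat)
    finally show "recover (signs_at (map real_poly Q) x) ! j = signs_at (map real_poly G) x ! j"
      using j by (simp add: recover_def signs_at_def)
  qed (simp add: recover_def signs_at_def)
  moreover have "set (factor_signs crb Q) = range (signs_at (map real_poly Q))"
    using fac assms(2) by (intro set_factor_signs) auto
  ultimately show ?thesis
    by (simp add: find_consistent_signs_def F recover_def[symmetric] image_image del: map_map)
qed

text \<open>\<open>holds\<close> sees only positivity and vanishing, so rational signs may replace
  real values although the two valuations have different types.\<close>

lemma holds_cong:
  assumes "\<And>g. g \<in> set (atom_polys \<phi>) \<Longrightarrow> (v g > 0 \<longleftrightarrow> w g > 0) \<and> (v g = 0 \<longleftrightarrow> w g = 0)"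
  shows "holds v \<phi> \<longleftrightarrow> holds w \<phi>"
  using assms by (induction \<phi>) (auto simp: order_le_less)

lemma true_at_signs_signs_at:
  "true_at_signs \<phi> (signs_at (map real_poly (polys_of \<phi>)) x) \<longleftrightarrow> true_at \<phi> x"
proof -
  have "the (map_of (zip (polys_of \<phi>) (signs_at (map real_poly (polys_of \<phi>)) x)) g) =
      sgn_rat (poly (real_poly g) x)" if "g \<in> set (atom_polys \<phi>)" for g
    using that by (simp add: signs_at_def polys_of_def o_def map_of_zip_map)
  then show ?thesis
    unfolding true_at_signs_def true_at_def by (intro holds_cong) simp
qed

theorem mainTheorem1:
  fixes factorize :: "rat poly list \<Rightarrow> rat poly list \<times> (nat \<Rightarrow> rat) \<times> (nat \<Rightarrow> nat \<Rightarrow> nat)"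
    and crb :: "rat poly \<Rightarrow> nat"
    and \<phi> :: fml
  assumes "factorization_procedure factorize"
    and "root_bound_procedure crb"
  shows "((\<forall>x::real. true_at \<phi> x) \<longleftrightarrow> decide_universal factorize crb \<phi>) \<and>
         ((\<exists>x::real. true_at \<phi> x) \<longleftrightarrow> decide_existential factorize crb \<phi>)"
  using set_find_consistent_signs[OF assms, of "polys_of \<phi>"]
  by (simp add: decide_universal_def decide_existential_def list_all_iff list_ex_iff
      true_at_signs_signs_at)

end
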